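(* Let $m\ge2$ and $n\ge 1$ be integers, and let $\mathbf{T}=(T_1,\dots,T_m)$ be a commuting $m$-tuple of (bounded) backward weighted shifts on a Hilbert space $\mathcal{H}$ with reproducing kernel $K(z,w)=\sum_{\alpha\in\mathbf{Z}_+^m}\rho(\alpha)z^\alpha\overline{w}^\alpha$, where $\rho(\alpha)>0$ for all $\alpha$. If $\mathbf{T}$ is an $n$-hypercontraction, then for every non-zero $\alpha=(\alpha_1,\dots,\alpha_m)\in\mathbf{Z}_+^m$, $$\sum_{\substack{\beta\in\mathbf{Z}_+^m\\ \beta\le\alpha\\ |\alpha-\beta|=1}}\frac{\rho(\beta)}{\rho(\alpha)}\le\frac{|\alpha|}{|\alpha|+n-1}.$$
   Context: $\mathbf{Z}_+^m$ is the set of $m$-tuples of nonnegative integers; $|\alpha|=\alpha_1+\cdots+\alpha_m$; $\beta\le\alpha$ means $\beta_i\le\alpha_i$ for all $i$; $e_i\in\mathbf{Z}_+^m$ has $1$ in the $i$th position and $0$ elsewhere. Backward weighted shifts: the Hilbert space $\mathcal{H}$ with reproducing kernel $\sum_\alpha\rho(\alpha)z^\alpha\overline{w}^\alpha$ has orthonormal basis $\mathbf{e}_\alpha(z)=\sqrt{\rho(\alpha)}z^\alpha$, $\alpha\in\mathbf{Z}_+^m$, and $T_i=M_{z_i}^*$ is the adjoint of multiplication by the coordinate function $z_i$, assumed bounded: $T_i\mathbf{e}_\alpha=\sqrt{\rho(\alpha-e_i)/\rho(\alpha)}\,\mathbf{e}_{\alpha-e_i}$ if $\alpha_i\ge1$,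 and $T_i\mathbf{e}_\alpha=0$ if $\alpha_i=0$. $n$-hypercontraction: for a commuting tuple $\mathbf{T}$ of bounded operators on $\mathcal{H}$ let $\mathbf{M}_{\mathbf{T}}(X)=\sum_{i=1}^mT_i^*XT_i$ for bounded $X$ on $\mathcal{H}$. $\mathbf{T}$ is an $n$-hypercontraction if $(I-\mathbf{M}_{\mathbf{T}})^k(I)=\sum_{j=0}^k(-1)^j\binom{k}{j}\mathbf{M}_{\mathbf{T}}^j(I)\ge0$ for all $1\le k\le n$. *)

theory Defs
  imports "HOL-Analysis.Analysis"
begin

text \<open>
  Multi-indices in \<open>\<int>\<^sub>+\<^sup>m\<close> are vectors of type \<open>nat ^ 'm\<close>, with \<open>m = CARD('m)\<close>; their order
  and subtraction are the componentwise ones of the library.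
\<close>

definition mdeg :: "nat ^ 'm \<Rightarrow> nat"
  where "mdeg \<alpha> = (\<Sum>i\<in>UNIV. \<alpha> $ i)"

definition monomial :: "nat ^ 'm \<Rightarrow> complex ^ 'm \<Rightarrow> complex"
  where "monomial \<alpha> z = (\<Prod>i\<in>UNIV. (z $ i) ^ (\<alpha> $ i))"


text \<open>
  The library has no complex Hilbert spaces. The ones needed here consist of scalar functions,
  so a Hilbert space is a set \<open>H\<close> of functions that is a subspace for the pointwise operations,
  together with an inner product \<open>ip\<close> (linear in the first argument), of which only the values
  on \<open>H\<close> matter.
\<close>

definition hnorm :: "(('a \<Rightarrow> complex) \<Rightarrow> ('a \<Rightarrow> complex) \<Rightarrow> complex) \<Rightarrow> ('a \<Rightarrow> complex) \<Rightarrow> real"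
  where "hnorm ip f = sqrt (Re (ip f f))"

locale function_hilbert_space =
  fixes H :: "('a \<Rightarrow> complex) set"
    and ip :: "('a \<Rightarrow> complex) \<Rightarrow> ('a \<Rightarrow> complex) \<Rightarrow> complex"
  assumes zero_mem: "(\<lambda>z. 0) \<in> H"
    and add_mem: "\<And>f g. f \<in> H \<Longrightarrow> g \<in> H \<Longrightarrow> (\<lambda>z. f z + g z) \<in> H"
    and scale_mem: "\<And>c f. f \<in> H \<Longrightarrow> (\<lambda>z. c * f z) \<in> H"
    and ip_add: "\<And>f g h. f \<in> H \<Longrightarrow> g \<in> H \<Longrightarrow> h \<in> H \<Longrightarrow>
                   ip (\<lambda>z. f z + g z) h = ip f h + ip g h"
    and ip_scale: "\<And>c f g. f \<in> H \<Longrightarrow> g \<in> H \<Longrightarrow> ip (\<lambda>z. c * f z) g = c * ip f g"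
    and ip_cnj: "\<And>f g. f \<in> H \<Longrightarrow> g \<in> H \<Longrightarrow> ip g f = cnj (ip f g)"
    and ip_nonneg: "\<And>f. f \<in> H \<Longrightarrow> ip f f \<in> \<real>\<^sub>\<ge>\<^sub>0"
    and ip_definite: "\<And>f. f \<in> H \<Longrightarrow> ip f f = 0 \<Longrightarrow> f = (\<lambda>z. 0)"
    and complete: "\<And>F :: nat \<Rightarrow> 'a \<Rightarrow> complex.
           (\<And>k. F k \<in> H) \<Longrightarrow>
           (\<And>\<epsilon>. \<epsilon> > 0 \<Longrightarrow> \<exists>N. \<forall>k\<ge>N. \<forall>l\<ge>N. hnorm ip (\<lambda>z. F k z - F l z) < \<epsilon>) \<Longrightarrow>
           \<exists>f\<in>H. (\<lambda>k. hnorm ip (\<lambda>z. F k z - f z)) \<longlonglongrightarrow> 0"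

text \<open>
  Functions on a set \<open>\<Omega>\<close> are represented by functions on the whole type that vanish off \<open>\<Omega>\<close>,
  so that equality in \<open>H\<close> is equality on \<open>\<Omega>\<close>.
\<close>

locale reproducing_kernel_hilbert_space = function_hilbert_space H ip
  for \<Omega> :: "'a set"
    and K :: "'a \<Rightarrow> 'a \<Rightarrow> complex"
    and H :: "('a \<Rightarrow> complex) set"
    and ip :: "('a \<Rightarrow> complex) \<Rightarrow> ('a \<Rightarrow> complex) \<Rightarrow> complex" +
  assumes support: "\<And>f z. f \<in> H \<Longrightarrow> z \<notin> \<Omega> \<Longrightarrow> f z = 0"
    and kernel_mem: "\<And>w. w \<in> \<Omega> \<Longrightarrow> (\<lambda>z. if z \<in> \<Omega> then K z w else 0) \<in> H"
    and reproducing: "\<And>f w. f \<in> H \<Longrightarrow> w \<in> \<Omega> \<Longrightarrow> ip f (\<lambda>z. if z \<in> \<Omega> then K z w else 0) = f w"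


text \<open>
  Operators on \<open>H\<close> are functions on the whole function type of which only the restriction to
  \<open>H\<close> matters.
\<close>

definition bounded_operator ::
  "('a \<Rightarrow> complex) set \<Rightarrow> (('a \<Rightarrow> complex) \<Rightarrow> ('a \<Rightarrow> complex) \<Rightarrow> complex) \<Rightarrow>
   (('a \<Rightarrow> complex) \<Rightarrow> ('a \<Rightarrow> complex)) \<Rightarrow> bool"
  where "bounded_operator H ip A \<longleftrightarrow>
    (\<forall>f\<in>H. A f \<in> H) \<and>
    (\<forall>f\<in>H. \<forall>g\<in>H. A (\<lambda>z. f z + g z) = (\<lambda>z. A f z + A g z)) \<and>
    (\<forall>c. \<forall>f\<in>H. A (\<lambda>z. c * f z) = (\<lambda>z. c * A f z)) \<and>
    (\<exists>C. \<forall>f\<in>H. hnorm ip (A f) \<le> C * hnorm ip f)"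

definition is_adjoint ::
  "('a \<Rightarrow> complex) set \<Rightarrow> (('a \<Rightarrow> complex) \<Rightarrow> ('a \<Rightarrow> complex) \<Rightarrow> complex) \<Rightarrow>
   (('a \<Rightarrow> complex) \<Rightarrow> ('a \<Rightarrow> complex)) \<Rightarrow> (('a \<Rightarrow> complex) \<Rightarrow> ('a \<Rightarrow> complex)) \<Rightarrow> bool"
  where "is_adjoint H ip A B \<longleftrightarrow>
    (\<forall>g\<in>H. B g \<in> H) \<and> (\<forall>f\<in>H. \<forall>g\<in>H. ip (A f) g = ip f (B g))"

text \<open>
  For a bounded operator on a Hilbert space the choice is possible, and it is unique on \<open>H\<close>.
\<close>

definition hadjoint ::
  "('a \<Rightarrow> complex) set \<Rightarrow> (('a \<Rightarrow> complex) \<Rightarrow> ('a \<Rightarrow> complex) \<Rightarrow> complex) \<Rightarrow>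
   (('a \<Rightarrow> complex) \<Rightarrow> ('a \<Rightarrow> complex)) \<Rightarrow> (('a \<Rightarrow> complex) \<Rightarrow> ('a \<Rightarrow> complex))"
  where "hadjoint H ip A = (SOME B. is_adjoint H ip A B)"

definition positive_operator ::
  "('a \<Rightarrow> complex) set \<Rightarrow> (('a \<Rightarrow> complex) \<Rightarrow> ('a \<Rightarrow> complex) \<Rightarrow> complex) \<Rightarrow>
   (('a \<Rightarrow> complex) \<Rightarrow> ('a \<Rightarrow> complex)) \<Rightarrow> bool"
  where "positive_operator H ip A \<longleftrightarrow> (\<forall>f\<in>H. ip (A f) f \<in> \<real>\<^sub>\<ge>\<^sub>0)"

definition commuting_tuple ::
  "('a \<Rightarrow> complex) set \<Rightarrow> (('a \<Rightarrow> complex) \<Rightarrow> ('a \<Rightarrow> complex) \<Rightarrow> complex) \<Rightarrow>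
   ('i \<Rightarrow> ('a \<Rightarrow> complex) \<Rightarrow> ('a \<Rightarrow> complex)) \<Rightarrow> bool"
  where "commuting_tuple H ip T \<longleftrightarrow>
    (\<forall>i. bounded_operator H ip (T i)) \<and>
    (\<forall>i j. \<forall>f\<in>H. T i (T j f) = T j (T i f))"

text \<open>The map \<open>\<^bold>M\<^sub>T(X) = \<Sum>\<^sub>i T\<^sub>i\<^sup>* X T\<^sub>i\<close> and the operators \<open>(I - \<^bold>M\<^sub>T)\<^sup>k(I)\<close>.\<close>

definition conj_map ::
  "('a \<Rightarrow> complex) set \<Rightarrow> (('a \<Rightarrow> complex) \<Rightarrow> ('a \<Rightarrow> complex) \<Rightarrow> complex) \<Rightarrow>
   ('i::finite \<Rightarrow> ('a \<Rightarrow> complex) \<Rightarrow> ('a \<Rightarrow> complex)) \<Rightarrow>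
   (('a \<Rightarrow> complex) \<Rightarrow> ('a \<Rightarrow> complex)) \<Rightarrow> (('a \<Rightarrow> complex) \<Rightarrow> ('a \<Rightarrow> complex))"
  where "conj_map H ip T X = (\<lambda>f z. \<Sum>i\<in>UNIV. hadjoint H ip (T i) (X (T i f)) z)"

definition defect_operator ::
  "('a \<Rightarrow> complex) set \<Rightarrow> (('a \<Rightarrow> complex) \<Rightarrow> ('a \<Rightarrow> complex) \<Rightarrow> complex) \<Rightarrow>
   ('i::finite \<Rightarrow> ('a \<Rightarrow> complex) \<Rightarrow> ('a \<Rightarrow> complex)) \<Rightarrow> nat \<Rightarrow>
   (('a \<Rightarrow> complex) \<Rightarrow> ('a \<Rightarrow> complex))"
  where "defect_operator H ip T k =
    (\<lambda>f z. \<Sum>j=0..k. (-1) ^ j * of_nat (k choose j) * (conj_map H ip T ^^ j) id f z)"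

definition hypercontraction ::
  "('a \<Rightarrow> complex) set \<Rightarrow> (('a \<Rightarrow> complex) \<Rightarrow> ('a \<Rightarrow> complex) \<Rightarrow> complex) \<Rightarrow>
   nat \<Rightarrow> ('i::finite \<Rightarrow> ('a \<Rightarrow> complex) \<Rightarrow> ('a \<Rightarrow> complex)) \<Rightarrow> bool"
  where "hypercontraction H ip n T \<longleftrightarrow>
    commuting_tuple H ip T \<and>
    (\<forall>k\<in>{1..n}. positive_operator H ip (defect_operator H ip T k))"


definition mult_coord :: "'m \<Rightarrow> (complex ^ 'm \<Rightarrow> complex) \<Rightarrow> (complex ^ 'm \<Rightarrow> complex)"
  where "mult_coord i f = (\<lambda>z. z $ i * f z)"

text \<open>
  The Hilbert space on \<open>\<Omega>\<close> with reproducing kernel \<open>K(z, w) = \<Sum>\<^sub>\<alpha> \<rho>(\<alpha>) z\<^sup>\<alpha> w\<^sup>\<alpha>\<close> (second factor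
  conjugated), where the series converges on an open neighbourhood \<open>\<Omega>\<close> of the origin; this is
  what makes the functions \<open>sqrt (\<rho> \<alpha>) z\<^sup>\<alpha>\<close> an orthonormal basis.
\<close>

definition power_series_kernel_space ::
  "(nat ^ 'm \<Rightarrow> real) \<Rightarrow> (complex ^ 'm) set \<Rightarrow> (complex ^ 'm \<Rightarrow> complex) set \<Rightarrow>
   ((complex ^ 'm \<Rightarrow> complex) \<Rightarrow> (complex ^ 'm \<Rightarrow> complex) \<Rightarrow> complex) \<Rightarrow> bool"
  where "power_series_kernel_space \<rho> \<Omega> H ip \<longleftrightarrow>
    open \<Omega> \<and> 0 \<in> \<Omega> \<and>
    (\<exists>K. reproducing_kernel_hilbert_space \<Omega> K H ip \<and>
      (\<forall>z\<in>\<Omega>. \<forall>w\<in>\<Omega>.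
        ((\<lambda>\<alpha>. of_real (\<rho> \<alpha>) * monomial \<alpha> z * cnj (monomial \<alpha> w)) has_sum K z w) UNIV))"

text \<open>
  On the basis \<open>e\<^sub>\<alpha> = sqrt (\<rho> \<alpha>) z\<^sup>\<alpha>\<close>, the adjoint of multiplication by \<open>z\<^sub>i\<close> maps \<open>e\<^sub>\<alpha>\<close> to
  \<open>sqrt (\<rho> (\<alpha> - \<epsilon>\<^sub>i) / \<rho> \<alpha>) e\<^bsub>\<alpha> - \<epsilon>\<^sub>i\<^esub>\<close>, where \<open>\<epsilon>\<^sub>i = axis i 1\<close>, and to \<open>0\<close> if \<open>\<alpha> $ i = 0\<close>.
\<close>

definition backward_weighted_shifts ::
  "(complex ^ 'm \<Rightarrow> complex) set \<Rightarrow>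
   ((complex ^ 'm \<Rightarrow> complex) \<Rightarrow> (complex ^ 'm \<Rightarrow> complex) \<Rightarrow> complex) \<Rightarrow>
   ('m \<Rightarrow> (complex ^ 'm \<Rightarrow> complex) \<Rightarrow> (complex ^ 'm \<Rightarrow> complex)) \<Rightarrow> bool"
  where "backward_weighted_shifts H ip T \<longleftrightarrow>
    (\<forall>i. bounded_operator H ip (mult_coord i) \<and> bounded_operator H ip (T i) \<and>
         is_adjoint H ip (mult_coord i) (T i))"

end

theory Submission
  imports Defs
begin

text \<open>
  Write \<open>S u(\<alpha>) = \<Sum>\<^sub>i u(\<alpha> - \<epsilon>\<^sub>i)\<close>, the sum over all \<open>i\<close> with \<open>\<alpha>\<^sub>i \<ge> 1\<close>, and \<open>D = 1 - S\<close>. The sum to be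
  bounded is \<open>S \<rho>(\<alpha>) / \<rho>(\<alpha>)\<close>. The proof has two independent halves.

  Operator theory gives \<open>D\<^sup>n \<rho> \<ge> 0\<close>. On coefficients of power series in \<open>z\<close> and the conjugate of
  \<open>w\<close>, multiplication by \<open>\<langle>z, w\<rangle> = \<Sum>\<^sub>i z\<^sub>i cnj w\<^sub>i\<close> acts as \<open>S\<close>, so \<open>(1 - \<langle>z, w\<rangle>)\<^sup>n K(z, w)\<close> has
  coefficients \<open>D\<^sup>n \<rho>\<close> (\<open>has_sum_shift_diff_funpow\<close>). Since \<open>T\<^sub>i\<close> maps the kernel function at \<open>w\<close> to
  its multiple by \<open>cnj w\<^sub>i\<close>, and \<open>T\<^sub>i\<^sup>*\<close> is multiplication by \<open>z\<^sub>i\<close>, the quadratic form of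
  \<open>(I - \<^bold>M\<^sub>T)\<^sup>n(I)\<close> on finite combinations of kernel functions is the one of this same kernel
  (\<open>ip_defect_operator_kernel_combination\<close>). Its positivity makes the kernel positive definite.
  A positive definite series of this diagonal shape has nonnegative coefficients: averaging over
  points whose coordinates are roots of unity, times a small radius, leaves only the coefficients
  in one residue class, and for large order of the roots the desired one dominates
  (\<open>coefficients_nonneg_if_positive_definite\<close>). Working with kernel functions at finitely many
  points replaces the usual evaluation on the orthonormal basis of monomials.

  Algebra turns \<open>D\<^sup>n \<rho> \<ge> 0\<close> into \<open>(n - 1) S \<rho> \<le> N D \<rho>\<close>, where \<open>N u(\<alpha>) = |\<alpha>| u(\<alpha>)\<close>
  (\<open>shift_sum_le_mdeg_shift_diff\<close>); this is the assertion, as it reads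
  \<open>(|\<alpha>| + n - 1) S \<rho>(\<alpha>) \<le> |\<alpha>| \<rho>(\<alpha>)\<close>. The induction on \<open>n\<close> rests on the commutation relation
  \<open>D N = N D + S\<close> and on the fact that \<open>D v \<ge> 0\<close> implies \<open>v \<ge> 0\<close>.
\<close>

section \<open>The difference inequality on multi-index functions\<close>

definition shift_sum :: "(nat ^ 'm \<Rightarrow> real) \<Rightarrow> nat ^ 'm \<Rightarrow> real"
  where "shift_sum u \<alpha> = (\<Sum>i | \<alpha> $ i \<ge> 1. u (\<alpha> - axis i 1))"

definition shift_diff :: "(nat ^ 'm \<Rightarrow> real) \<Rightarrow> nat ^ 'm \<Rightarrow> real"
  where "shift_diff u \<alpha> = u \<alpha> - shift_sum u \<alpha>"

lemma mdeg_add: "mdeg (\<alpha> + \<beta>) = mdeg \<alpha> + mdeg \<beta>"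
  by (simp add: mdeg_def sum.distrib)

lemma mdeg_axis: "mdeg (axis i k) = k"
  by (simp add: mdeg_def axis_def)

lemma minus_axis_add_axis:
  fixes \<alpha> :: "nat ^ 'm"
  assumes "\<alpha> $ i \<ge> 1"
  shows "\<alpha> - axis i 1 + axis i 1 = \<alpha>"
  using assms by (auto simp: vec_eq_iff axis_def)

lemma mdeg_minus_axis:
  fixes \<alpha> :: "nat ^ 'm"
  assumes "\<alpha> $ i \<ge> 1"
  shows "mdeg \<alpha> = Suc (mdeg (\<alpha> - axis i 1))"
  using mdeg_add[of "\<alpha> - axis i 1" "axis i 1"]
  by (simp only: minus_axis_add_axis[OF assms] mdeg_axis)

lemma shift_sum_linear:
  "shift_sum (\<lambda>\<beta>. a * u \<beta> + b * v \<beta>) \<alpha> = a * shift_sum u \<alpha> + b * shift_sum v \<alpha>"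
  by (simp add: shift_sum_def sum.distrib sum_distrib_left)

text \<open>
  Lowering one entry by one lowers the degree by one; thus \<open>S N = (N - 1) S\<close>, which is the
  commutation relation \<open>D N = N D + S\<close>.
\<close>

lemma shift_sum_mdeg:
  "shift_sum (\<lambda>\<beta>. real (mdeg \<beta>) * u \<beta>) \<alpha> = (real (mdeg \<alpha>) - 1) * shift_sum u \<alpha>"
proof -
  have "real (mdeg (\<alpha> - axis i 1)) = real (mdeg \<alpha>) - 1" if "\<alpha> $ i \<ge> 1" for i
    using mdeg_minus_axis[OF that] by simp
  then show ?thesis
    by (simp add: shift_sum_def sum_distrib_left)
qed

text \<open>
  The inverse of \<open>1 - S\<close> is the series \<open>\<Sum>\<^sub>j S\<^sup>j\<close>, a finite sum at each multi-index, and it preserves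
  nonnegativity. Induction on the degree uses only \<open>v = S v + D v\<close>.
\<close>

lemma nonneg_if_shift_diff_nonneg:
  assumes "\<And>\<beta>. shift_diff v \<beta> \<ge> 0"
  shows "v \<alpha> \<ge> 0"
proof (induction "mdeg \<alpha>" arbitrary: \<alpha> rule: less_induct)
  case less
  have "v (\<alpha> - axis i 1) \<ge> 0" if "\<alpha> $ i \<ge> 1" for i
    using less mdeg_minus_axis[OF that] by simp
  then have "shift_sum v \<alpha> \<ge> 0"
    unfolding shift_sum_def by (intro sum_nonneg) simp
  with assms[of \<alpha>] show ?case
    by (simp add: shift_diff_def)
qed

text \<open>
  In terms of \<open>G = D\<^sup>n u\<close> the inequality is linear, and for \<open>G\<close> a unit mass at \<open>\<gamma>\<close> it compares
  \<open>j / (n + j - 1)\<close>, where \<open>j = |\<alpha> - \<gamma>|\<close>, with \<open>|\<alpha>| / (|\<alpha>| + n - 1)\<close>. The induction avoids the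
  binomial and multinomial coefficients of this expansion. In the step from exponent \<open>n\<close> to \<open>n + 1\<close>, with \<open>w = D u\<close> and \<open>v = N w - n S u\<close>,
  the relation \<open>D N = N D + S\<close> yields \<open>D v = N D w - (n - 1) S w\<close>, which is nonnegative by the
  inductive hypothesis for \<open>w\<close>. The exponent is written \<open>Suc n\<close>, so that the factor \<open>n - 1\<close> of this
  explanation is \<open>n\<close> in the statement.
\<close>

lemma shift_sum_le_mdeg_shift_diff:
  assumes "\<And>\<alpha>. (shift_diff ^^ Suc n) u \<alpha> \<ge> 0"
  shows "real n * shift_sum u \<alpha> \<le> real (mdeg \<alpha>) * shift_diff u \<alpha>"
  using assms
proof (induction n arbitrary: u \<alpha>)
  case 0
  then show ?case by simp
next
  case (Suc n)
  define w where "w = shift_diff u"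
  \<comment> \<open>The factor \<open>1\<close> makes the linearity rule for \<^const>\<open>shift_sum\<close> applicable by rewriting.\<close>
  define v where "v = (\<lambda>\<beta>. 1 * (real (mdeg \<beta>) * w \<beta>) + (- real (Suc n)) * shift_sum u \<beta>)"
  have IH: "real n * shift_sum w \<beta> \<le> real (mdeg \<beta>) * shift_diff w \<beta>" for \<beta>
    using Suc.IH[of w \<beta>] Suc.prems by (simp add: w_def funpow_swap1)
  have "shift_diff v \<beta> \<ge> 0" for \<beta>
  proof -
    have SS: "shift_sum (shift_sum u) \<beta> = shift_sum u \<beta> - shift_sum w \<beta>"
      using shift_sum_linear[of 1 u "-1" "shift_sum u" \<beta>] 
      by (simp add: w_def shift_diff_def[abs_def])
    have wu: "w \<beta> = u \<beta> - shift_sum u \<beta>"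
      by (simp add: w_def shift_diff_def)
    have "shift_diff v \<beta> = real (mdeg \<beta>) * shift_diff w \<beta> - real n * shift_sum w \<beta>"
      unfolding shift_diff_def[of v] shift_diff_def[of w]
      unfolding v_def shift_sum_linear shift_sum_mdeg SS
      by (simp add: wu algebra_simps)
    with IH show ?thesis by simp
  qed
  from nonneg_if_shift_diff_nonneg[OF this, of \<alpha>] show ?case
    by (simp add: v_def w_def algebra_simps)
qed

lemma sum_lower_neighbours:
  fixes \<alpha> :: "nat ^ 'm" and u :: "nat ^ 'm \<Rightarrow> real"
  shows "(\<Sum>\<beta> | \<beta> \<le> \<alpha> \<and> mdeg (\<alpha> - \<beta>) = 1. u \<beta>) = shift_sum u \<alpha>"
proof -
  have "bij_betw (\<lambda>i. \<alpha> - axis i 1) {i. \<alpha> $ i \<ge> 1} {\<beta>. \<beta> \<le> \<alpha> \<and> mdeg (\<alpha> - \<beta>) = 1}"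
  proof (rule bij_betw_imageI)
    show "inj_on (\<lambda>i. \<alpha> - axis i 1) {i. \<alpha> $ i \<ge> 1}"
    proof (rule inj_onI)
      fix i j
      assume i: "i \<in> {i. \<alpha> $ i \<ge> 1}" and j: "j \<in> {i. \<alpha> $ i \<ge> 1}"
        and eq: "\<alpha> - axis i 1 = \<alpha> - axis j 1"
      from eq have "(\<alpha> - axis i 1) $ i = (\<alpha> - axis j 1) $ i" by simp
      with i show "i = j" by (auto simp: axis_def split: if_splits)
    qed
    show "(\<lambda>i. \<alpha> - axis i 1) ` {i. \<alpha> $ i \<ge> 1} = {\<beta>. \<beta> \<le> \<alpha> \<and> mdeg (\<alpha> - \<beta>) = 1}"
    proof (intro equalityI subsetI)
      fix \<beta> assume "\<beta> \<in> (\<lambda>i. \<alpha> - axis i 1) ` {i. \<alpha> $ i \<ge> 1}"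
      then obtain i where i: "\<alpha> $ i \<ge> 1" and \<beta>: "\<beta> = \<alpha> - axis i 1" by auto
      have "\<alpha> - \<beta> = axis i 1"
        using i by (auto simp: \<beta> vec_eq_iff axis_def)
      moreover have "\<beta> \<le> \<alpha>" by (auto simp: \<beta> less_eq_vec_def)
      ultimately show "\<beta> \<in> {\<beta>. \<beta> \<le> \<alpha> \<and> mdeg (\<alpha> - \<beta>) = 1}" by (simp add: mdeg_axis)
    next
      fix \<beta> assume "\<beta> \<in> {\<beta>. \<beta> \<le> \<alpha> \<and> mdeg (\<alpha> - \<beta>) = 1}"
      then have le: "\<beta> \<le> \<alpha>" and "(\<Sum>i\<in>UNIV. (\<alpha> - \<beta>) $ i) = 1" by (auto simp: mdeg_def)
      then obtain i where i: "(\<alpha> - \<beta>) $ i = 1" "\<And>j. j \<noteq> i \<Longrightarrow> (\<alpha> - \<beta>) $ j = 0"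
        using sum_eq_1_iff[of UNIV "\<lambda>i. (\<alpha> - \<beta>) $ i"] by auto
      have "\<beta> = \<alpha> - axis i 1"
        unfolding vec_eq_iff
      proof
        fix j
        show "\<beta> $ j = (\<alpha> - axis i 1) $ j"
          using i(1) i(2)[of j] le by (auto simp: axis_def less_eq_vec_def split: if_splits
              dest!: spec[of _ j])
      qed
      moreover have "\<alpha> $ i \<ge> 1" using i(1) by simp
      ultimately show "\<beta> \<in> (\<lambda>i. \<alpha> - axis i 1) ` {i. \<alpha> $ i \<ge> 1}" by blast
    qed
  qed
  then show ?thesis
    unfolding shift_sum_def by (rule sum.reindex_bij_betw[symmetric])
qed


section \<open>Multiplying a power series kernel by one minus the inner product\<close>

lemma has_sum_finite_sum:
  fixes f :: "'i \<Rightarrow> 'a \<Rightarrow> 'b :: topological_comm_monoid_add"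
  assumes "\<And>i. i \<in> I \<Longrightarrow> (f i has_sum s i) A"
  shows "((\<lambda>x. \<Sum>i\<in>I. f i x) has_sum (\<Sum>i\<in>I. s i)) A"
  using assms
  by (induction I rule: infinite_finite_induct) (auto intro!: has_sum_add)

lemma monomial_add_axis:
  fixes z :: "complex ^ 'm"
  shows "monomial (\<alpha> + axis i 1) z = z $ i * monomial \<alpha> z"
proof -
  have "monomial (\<alpha> + axis i 1) z = monomial \<alpha> z * (\<Prod>j\<in>UNIV. (z $ j) ^ (axis i 1 $ j))"
    by (simp add: monomial_def power_add prod.distrib)
  also have "(\<Prod>j\<in>UNIV. (z $ j) ^ (axis i 1 $ j)) = (\<Prod>j\<in>UNIV. if j = i then z $ j else 1)"
    by (rule prod.cong) (auto simp: axis_def)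
  finally show ?thesis by (simp add: mult.commute)
qed

text \<open>
  For each \<open>i\<close>, the factor \<open>z\<^sub>i cnj w\<^sub>i\<close> moves the term of index \<open>\<alpha>\<close> to index \<open>\<alpha> + \<epsilon>\<^sub>i\<close>; reindexing along
  this injection and summing over \<open>i\<close> gives the coefficients \<open>S u\<close>.
\<close>

lemma has_sum_shift_sum:
  fixes z w :: "complex ^ 'm" and u :: "nat ^ 'm \<Rightarrow> real"
  assumes "((\<lambda>\<alpha>. of_real (u \<alpha>) * monomial \<alpha> z * cnj (monomial \<alpha> w)) has_sum s) UNIV"
  shows "((\<lambda>\<alpha>. of_real (shift_sum u \<alpha>) * monomial \<alpha> z * cnj (monomial \<alpha> w))
           has_sum ((\<Sum>i\<in>UNIV. z $ i * cnj (w $ i)) * s)) UNIV"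
proof -
  let ?m = "\<lambda>\<alpha>. monomial \<alpha> z * cnj (monomial \<alpha> w)"
  have *: "((\<lambda>\<alpha>. if \<alpha> $ i \<ge> 1 then of_real (u (\<alpha> - axis i 1)) * ?m \<alpha> else 0)
          has_sum (z $ i * cnj (w $ i) * s)) UNIV" (is "(?f has_sum ?s) UNIV") for i
  proof -
    let ?h = "\<lambda>\<alpha> :: nat ^ 'm. \<alpha> + axis i 1"
    have inj: "inj ?h" by (simp add: inj_def)
    have axis_component: "axis i 1 $ i = (1 :: nat)" by (simp add: axis_def)
    have "((\<lambda>\<alpha>. z $ i * cnj (w $ i) * (of_real (u \<alpha>) * monomial \<alpha> z * cnj (monomial \<alpha> w)))
          has_sum ?s) UNIV"
      by (intro has_sum_cmult_right assms)
    also have "(\<lambda>\<alpha>. z $ i * cnj (w $ i) * (of_real (u \<alpha>) * monomial \<alpha> z * cnj (monomial \<alpha> w)))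
        = ?f \<circ> ?h"
      by (simp add: fun_eq_iff monomial_add_axis[where i = i, simplified] axis_component[simplified])
    finally have "(?f has_sum ?s) (range ?h)"
      unfolding has_sum_reindex[OF inj] .
    moreover have "?f \<alpha> = 0" if "\<alpha> \<notin> range ?h" for \<alpha>
      using that minus_axis_add_axis[of \<alpha> i] by (metis rangeI)
    ultimately show ?thesis
      by (subst has_sum_cong_neutral[where S = UNIV and T = "range ?h" and g = ?f]) auto
  qed
  have "((\<lambda>\<alpha>. \<Sum>i\<in>UNIV. if \<alpha> $ i \<ge> 1 then of_real (u (\<alpha> - axis i 1)) * ?m \<alpha> else 0)
          has_sum (\<Sum>i\<in>UNIV. z $ i * cnj (w $ i) * s)) UNIV"
    by (intro has_sum_finite_sum *)
  also have "(\<lambda>\<alpha>. \<Sum>i\<in>UNIV. if \<alpha> $ i \<ge> 1 then of_real (u (\<alpha> - axis i 1)) * ?m \<alpha> else 0)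
     = (\<lambda>\<alpha>. of_real (shift_sum u \<alpha>) * monomial \<alpha> z * cnj (monomial \<alpha> w))"
    by (simp add: fun_eq_iff shift_sum_def sum.If_cases sum_distrib_right mult.assoc)
  finally show ?thesis
    by (simp add: sum_distrib_right)
qed

lemma has_sum_shift_diff_funpow:
  fixes z w :: "complex ^ 'm" and u :: "nat ^ 'm \<Rightarrow> real"
  assumes "((\<lambda>\<alpha>. of_real (u \<alpha>) * monomial \<alpha> z * cnj (monomial \<alpha> w)) has_sum s) UNIV"
  shows "((\<lambda>\<alpha>. of_real ((shift_diff ^^ n) u \<alpha>) * monomial \<alpha> z * cnj (monomial \<alpha> w))
           has_sum ((1 - (\<Sum>i\<in>UNIV. z $ i * cnj (w $ i))) ^ n * s)) UNIV"
proof (induction n)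
  case 0
  then show ?case using assms by simp
next
  case (Suc n)
  show ?case
    using has_sum_add[OF Suc has_sum_uminusI[OF has_sum_shift_sum[OF Suc]]]
    by (simp add: shift_diff_def algebra_simps)
qed


section \<open>Coefficients of a positive definite power series\<close>

text \<open>
  If \<open>F\<close> carries almost all of the absolute sum, then \<open>infsum b S\<close> differs little from \<open>b x\<close> as soon
  as \<open>S\<close> contains \<open>x\<close> and no other point of \<open>F\<close>.
\<close>

lemma nonneg_if_isolating_sums_nonneg:
  fixes b :: "'a \<Rightarrow> real"
  assumes summable: "b summable_on UNIV"
    and isolating: "\<And>F. finite F \<Longrightarrow> \<exists>S. x \<in> S \<and> S \<inter> F \<subseteq> {x} \<and> infsum b S \<ge> 0"
  shows "b x \<ge> 0"
proof (rule ccontr)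
  assume "\<not> b x \<ge> 0"
  then have neg: "- b x > 0" by simp
  let ?n = "\<lambda>y. \<bar>b y\<bar>"
  have abs: "?n summable_on A" for A
    using summable summable_on_iff_abs_summable_on_real[of b UNIV]
    by (auto intro: summable_on_subset_banach)
  have sumb: "b summable_on A" for A
    using summable by (auto intro: summable_on_subset_banach)
  from has_sum_finite_approximation[OF has_sum_infsum[OF abs[of UNIV]], of "- b x / 2"] neg
  obtain F where F: "finite F" "dist (sum ?n F) (infsum ?n UNIV) \<le> - b x / 2" by auto
  from isolating[OF F(1)] obtain S where S: "x \<in> S" "S \<inter> F \<subseteq> {x}" "infsum b S \<ge> 0" by auto
  have "infsum b (S - {x}) \<le> infsum ?n (S - {x})"
    by (intro infsum_mono sumb abs) auto
  also have "\<dots> \<le> infsum ?n (UNIV - F)"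
    by (intro infsum_mono2 abs) (use S in auto)
  also have "\<dots> = infsum ?n UNIV - sum ?n F"
    using F(1) by (subst infsum_Diff) (auto intro: abs)
  also have "\<dots> < - b x"
    using F(2) neg by (simp add: dist_real_def)
  finally have "infsum b (S - {x}) < - b x" .
  moreover have "infsum b S = b x + infsum b (S - {x})"
    using S(1) sumb[of "S - {x}"] infsum_insert[of b "S - {x}" x] by (simp add: insert_absorb)
  ultimately show False using S(3) by simp
qed

lemma root_of_unity_orthogonality:
  assumes "N > 0"
  obtains \<omega> :: complex where "norm \<omega> = 1"
    and "\<And>a b :: nat. (\<Sum>q<N. cnj (\<omega> ^ (q * a)) * \<omega> ^ (q * b))
                 = (if a mod N = b mod N then of_nat N else 0)"
proof
  define \<omega> where "\<omega> = exp (2 * of_real pi * \<i> / of_nat N)"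
  show norm1: "norm \<omega> = 1"
    by (simp add: \<omega>_def norm_exp_eq_Re)
  fix a b :: nat
  define u where "u = cnj (\<omega> ^ a) * \<omega> ^ b"
  have pow: "\<omega> ^ k = exp (2 * of_real pi * \<i> * of_nat k / of_nat N)" for k
    by (simp add: \<omega>_def exp_of_nat_mult[symmetric] mult_ac)
  have eq_iff: "\<omega> ^ a = \<omega> ^ b \<longleftrightarrow> a mod N = b mod N"
    unfolding pow using assms by (intro complex_root_unity_eq) simp
  have cancel: "\<omega> ^ k * cnj (\<omega> ^ k) = 1" for k
    by (simp add: complex_norm_square[symmetric] norm_power norm1 del: complex_cnj_power)
  have u1: "u = 1 \<longleftrightarrow> a mod N = b mod N"
  proof -
    have "\<omega> ^ a * u = \<omega> ^ b"
      using cancel[of a] by (simp add: u_def mult.assoc[symmetric])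
    then have "u = 1 \<longleftrightarrow> \<omega> ^ a = \<omega> ^ b"
      using norm1 by (metis cancel mult_cancel_left mult_zero_left mult.right_neutral zero_neq_one)
    then show ?thesis by (simp add: eq_iff)
  qed
  have "\<omega> ^ N = 1"
    using assms by (simp add: pow)
  then have pow_N: "(\<omega> ^ k) ^ N = 1" for k
    by (metis mult.commute power_mult power_one)
  then have uN: "u ^ N = 1"
    by (simp add: u_def power_mult_distrib pow_N flip: complex_cnj_power)
  have "(\<Sum>q<N. cnj (\<omega> ^ (q * a)) * \<omega> ^ (q * b)) = (\<Sum>q<N. u ^ q)"
    by (intro sum.cong)
      (simp_all add: u_def power_mult_distrib power_mult[symmetric] mult.commute)
  also have "\<dots> = (if a mod N = b mod N then of_nat N else 0)"
    using u1 uN by (auto simp: geometric_sum)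
  finally show "(\<Sum>q<N. cnj (\<omega> ^ (q * a)) * \<omega> ^ (q * b))
      = (if a mod N = b mod N then of_nat N else 0)" .
qed

text \<open>
  For weights \<open>c\<^sub>p\<close> at points \<open>W\<^sub>p\<close> the quadratic form is
  \<open>\<Sum>\<^sub>\<beta> a(\<beta>) |X\<^sub>\<beta>|\<^sup>2\<close> with \<open>X\<^sub>\<beta> = \<Sum>\<^sub>q cnj c\<^sub>q W\<^sub>q\<^sup>\<beta>\<close>. Taking for \<open>W\<^sub>q\<close> all points with coordinates
  \<open>r\<close> times an \<open>N\<close>-th root of unity, and for \<open>c\<close> the character that belongs to \<open>\<alpha>\<close>, makes \<open>X\<^sub>\<beta>\<close>
  vanish unless \<open>\<beta>\<close> and \<open>\<alpha>\<close> agree modulo \<open>N\<close>. For large \<open>N\<close> this isolates \<open>\<alpha>\<close> from any given finite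
  set of indices. The index type \<open>'m \<Rightarrow> nat\<close> of the point families is that of the
  exponents of these roots of unity.
\<close>

lemma coefficients_nonneg_if_positive_definite:
  fixes a :: "nat ^ 'm \<Rightarrow> real" and L :: "complex ^ 'm \<Rightarrow> complex ^ 'm \<Rightarrow> complex"
  assumes "r > 0"
    and expansion: "\<And>z w. (\<And>i. norm (z $ i) = r) \<Longrightarrow> (\<And>i. norm (w $ i) = r) \<Longrightarrow>
      ((\<lambda>\<alpha>. of_real (a \<alpha>) * monomial \<alpha> z * cnj (monomial \<alpha> w)) has_sum L z w) UNIV"
    and positive: "\<And>(P :: ('m \<Rightarrow> nat) set) c W. finite P \<Longrightarrow>
      (\<And>p i. p \<in> P \<Longrightarrow> norm (W p $ i) = r) \<Longrightarrow>
      0 \<le> Re (\<Sum>p\<in>P. \<Sum>q\<in>P. c p * cnj (c q) * L (W q) (W p))"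
  shows "a \<alpha> \<ge> 0"
proof -
  define b where "b = (\<lambda>\<beta>. a \<beta> * r ^ (2 * mdeg \<beta>))"
  have mono_norm: "norm (monomial \<beta> z) = r ^ mdeg \<beta>" if "\<And>i. norm (z $ i) = r" for \<beta> z
    using that unfolding monomial_def mdeg_def prod_norm[symmetric]
    by (simp add: norm_power power_sum)
  have "b summable_on UNIV"
  proof -
    let ?z = "(\<chi> i. of_real r) :: complex ^ 'm"
    have "((\<lambda>\<alpha>. of_real (a \<alpha>) * monomial \<alpha> ?z * cnj (monomial \<alpha> ?z)) has_sum L ?z ?z) UNIV"
      using \<open>r > 0\<close> by (intro expansion) auto
    moreover have "of_real (a \<beta>) * monomial \<beta> ?z * cnj (monomial \<beta> ?z) = of_real (b \<beta>)" for \<beta>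
    proof -
      have "of_real (a \<beta>) * monomial \<beta> ?z * cnj (monomial \<beta> ?z)
          = of_real (a \<beta>) * of_real ((norm (monomial \<beta> ?z))\<^sup>2)"
        by (simp only: mult.assoc complex_norm_square)
      also have "norm (monomial \<beta> ?z) = r ^ mdeg \<beta>"
        using \<open>r > 0\<close> by (intro mono_norm) simp
      finally show ?thesis
        by (simp add: b_def power_mult power2_eq_square power_mult_distrib)
    qed
    ultimately have "((\<lambda>\<beta>. complex_of_real (b \<beta>)) has_sum L ?z ?z) UNIV"
      by simp
    from has_sum_Re[OF this] show ?thesis
      by (auto intro: has_sum_imp_summable)
  qed
  \<comment> \<open>The isolating set is the residue class of \<open>\<alpha>\<close>, for a modulus above all entries in \<open>F\<close>.\<close>
  moreover have "\<exists>S. \<alpha> \<in> S \<and> S \<inter> F \<subseteq> {\<alpha>} \<and> infsum b S \<ge> 0" if "finite F" for F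
  proof -
    define N where "N = Suc (Max (mdeg ` insert \<alpha> F))"
    have less_N: "\<beta> $ i < N" if "\<beta> \<in> insert \<alpha> F" for \<beta> i
    proof -
      have "\<beta> $ i \<le> mdeg \<beta>" by (simp add: mdeg_def member_le_sum)
      also have "\<dots> \<le> Max (mdeg ` insert \<alpha> F)"
        using that \<open>finite F\<close> by (intro Max_ge) auto
      finally show ?thesis by (simp add: N_def)
    qed
    define S where "S = {\<beta>. \<forall>i. \<alpha> $ i mod N = \<beta> $ i mod N}"
    have "\<alpha> \<in> S" by (simp add: S_def)
    moreover have "S \<inter> F \<subseteq> {\<alpha>}"
    proof
      fix \<beta> assume \<beta>: "\<beta> \<in> S \<inter> F"
      then have "\<alpha> $ i = \<beta> $ i" for i
        using less_N[of \<alpha> i] less_N[of \<beta> i] unfolding S_def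
        by (metis (mono_tags, lifting) IntD1 IntD2 insertCI mem_Collect_eq mod_less)
      then show "\<beta> \<in> {\<alpha>}" by (simp add: vec_eq_iff)
    qed
    moreover have "infsum b S \<ge> 0"
    proof -
      have "N > 0" by (simp add: N_def)
      then obtain \<omega> :: complex where norm1: "norm \<omega> = 1"
        and orth: "\<And>a b :: nat. (\<Sum>q<N. cnj (\<omega> ^ (q * a)) * \<omega> ^ (q * b))
                 = (if a mod N = b mod N then of_nat N else 0)"
        using root_of_unity_orthogonality by blast
      define P where "P = (UNIV :: 'm set) \<rightarrow>\<^sub>E {..<N}"
      define W where "W = (\<lambda>q :: 'm \<Rightarrow> nat. (\<chi> i. of_real r * \<omega> ^ q i) :: complex ^ 'm)"
      define c where "c = (\<lambda>q :: 'm \<Rightarrow> nat. \<Prod>i\<in>UNIV. \<omega> ^ (q i * \<alpha> $ i))"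
      define C where "C = real N ^ CARD('m)"
      have "finite P" unfolding P_def by (intro finite_PiE) auto
      have W_norm: "norm (W q $ i) = r" for q i
        using \<open>r > 0\<close> by (simp add: W_def norm_mult norm_power norm1)
      have average: "(\<Sum>q\<in>P. cnj (c q) * monomial \<beta> (W q))
          = (if \<beta> \<in> S then of_real (r ^ mdeg \<beta> * C) else 0)" for \<beta>
      proof -
        have "(\<Sum>q\<in>P. cnj (c q) * monomial \<beta> (W q)) = (\<Sum>q\<in>P. \<Prod>i\<in>UNIV. of_real r ^ (\<beta> $ i) *
            (cnj (\<omega> ^ (q i * \<alpha> $ i)) * \<omega> ^ (q i * \<beta> $ i)))"
          by (intro sum.cong refl)
            (simp add: c_def monomial_def W_def prod.distrib[symmetric] power_mult_distrib
              power_mult mult_ac)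
        also have "\<dots> = (\<Prod>i\<in>UNIV. \<Sum>q<N. of_real r ^ (\<beta> $ i) *
            (cnj (\<omega> ^ (q * \<alpha> $ i)) * \<omega> ^ (q * \<beta> $ i)))"
          unfolding P_def by (subst prod_sum_PiE) auto
        also have "\<dots> = (\<Prod>i\<in>UNIV. of_real r ^ (\<beta> $ i) *
            (if \<alpha> $ i mod N = \<beta> $ i mod N then of_nat N else 0))"
          by (simp only: sum_distrib_left[symmetric] orth)
        also have "\<dots> = (if \<beta> \<in> S then of_real (r ^ mdeg \<beta> * C) else 0)"
          by (auto simp: S_def prod.distrib power_sum mdeg_def C_def)
        finally show ?thesis .
      qed
      define Q where "Q = (\<Sum>p\<in>P. \<Sum>q\<in>P. c p * cnj (c q) * L (W q) (W p))"
      have "((\<lambda>\<beta>. \<Sum>p\<in>P. \<Sum>q\<in>P. c p * cnj (c q) *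
            (of_real (a \<beta>) * monomial \<beta> (W q) * cnj (monomial \<beta> (W p)))) has_sum Q) UNIV"
        unfolding Q_def by (intro has_sum_finite_sum has_sum_cmult_right expansion W_norm)
      moreover have "(\<Sum>p\<in>P. \<Sum>q\<in>P. c p * cnj (c q) *
            (of_real (a \<beta>) * monomial \<beta> (W q) * cnj (monomial \<beta> (W p))))
          = of_real (if \<beta> \<in> S then C\<^sup>2 * b \<beta> else 0)" for \<beta>
      proof -
        let ?X = "\<Sum>q\<in>P. cnj (c q) * monomial \<beta> (W q)"
        have cnj_X: "cnj ?X = (\<Sum>p\<in>P. c p * cnj (monomial \<beta> (W p)))"
          by simp
        have "(\<Sum>p\<in>P. \<Sum>q\<in>P. c p * cnj (c q) *
            (of_real (a \<beta>) * monomial \<beta> (W q) * cnj (monomial \<beta> (W p))))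
            = of_real (a \<beta>) * (cnj ?X * ?X)"
          unfolding cnj_X sum_product by (simp add: sum_distrib_left mult_ac)
        also have "\<dots> = of_real (if \<beta> \<in> S then C\<^sup>2 * b \<beta> else 0)"
          unfolding average
          by (simp add: b_def power2_eq_square power_mult mult_ac power_mult_distrib)
        finally show ?thesis .
      qed
      ultimately have "((\<lambda>\<beta>. complex_of_real (if \<beta> \<in> S then C\<^sup>2 * b \<beta> else 0)) has_sum Q) UNIV"
        by simp
      from has_sum_Re[OF this]
      have "((\<lambda>\<beta>. if \<beta> \<in> S then C\<^sup>2 * b \<beta> else 0) has_sum Re Q) UNIV" by simp
      then have "((\<lambda>\<beta>. C\<^sup>2 * b \<beta>) has_sum Re Q) S"
        by (subst has_sum_cong_neutral[where S = S and T = UNIV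
              and g = "\<lambda>\<beta>. if \<beta> \<in> S then C\<^sup>2 * b \<beta> else 0"]) auto
      then have "C\<^sup>2 * infsum b S = Re Q"
        by (metis infsumI infsum_cmult_right')
      moreover have "Re Q \<ge> 0"
        unfolding Q_def by (intro positive \<open>finite P\<close> W_norm)
      moreover have "C\<^sup>2 > 0" using \<open>N > 0\<close> by (simp add: C_def)
      ultimately show ?thesis by (metis zero_le_mult_iff less_le_not_le)
    qed
    ultimately show ?thesis by blast
  qed
  ultimately have "b \<alpha> \<ge> 0" by (rule nonneg_if_isolating_sums_nonneg)
  then show ?thesis
    using zero_less_power[OF \<open>r > 0\<close>, of "2 * mdeg \<alpha>"] by (auto simp: b_def zero_le_mult_iff)
qed


section \<open>Defect operators on combinations of kernel functions\<close>

context function_hilbert_space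
begin

lemma sum_mem:
  assumes "finite P" "\<And>p. p \<in> P \<Longrightarrow> F p \<in> H"
  shows "(\<lambda>z. \<Sum>p\<in>P. c p * F p z) \<in> H"
  using assms
proof (induction P rule: finite_induct)
  case empty
  then show ?case by (simp add: zero_mem)
next
  case (insert p P)
  then have "(\<lambda>z. c p * F p z) \<in> H" "(\<lambda>z. \<Sum>p\<in>P. c p * F p z) \<in> H"
    by (auto intro: scale_mem)
  from add_mem[OF this] insert.hyps show ?case by simp
qed

lemma ip_sum_left:
  assumes "finite P" "\<And>p. p \<in> P \<Longrightarrow> F p \<in> H" "g \<in> H"
  shows "ip (\<lambda>z. \<Sum>p\<in>P. c p * F p z) g = (\<Sum>p\<in>P. c p * ip (F p) g)"
  using assms
proof (induction P rule: finite_induct)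
  case empty
  then show ?case using ip_scale[of g g 0] by simp
next
  case (insert p P)
  then show ?case
    by (simp add: ip_add ip_scale sum_mem scale_mem)
qed

lemma ip_sum_right:
  assumes "finite P" "\<And>p. p \<in> P \<Longrightarrow> F p \<in> H" "g \<in> H"
  shows "ip g (\<lambda>z. \<Sum>p\<in>P. c p * F p z) = (\<Sum>p\<in>P. cnj (c p) * ip g (F p))"
proof -
  have "ip g (\<lambda>z. \<Sum>p\<in>P. c p * F p z) = cnj (ip (\<lambda>z. \<Sum>p\<in>P. c p * F p z) g)"
    using assms by (intro ip_cnj sum_mem) auto
  also have "\<dots> = (\<Sum>p\<in>P. cnj (c p) * cnj (ip (F p) g))"
    using assms by (simp add: ip_sum_left)
  also have "\<dots> = (\<Sum>p\<in>P. cnj (c p) * ip g (F p))"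
    using assms by (intro sum.cong refl) (simp add: ip_cnj[symmetric])
  finally show ?thesis .
qed

lemma eq_if_ip_eq:
  assumes "f \<in> H" "g \<in> H" "\<And>h. h \<in> H \<Longrightarrow> ip h f = ip h g"
  shows "f = g"
proof -
  define d where "d = (\<lambda>z. f z + (- 1) * g z)"
  have m: "(\<lambda>z. (- 1) * g z) \<in> H" using assms(2) by (rule scale_mem)
  have d: "d \<in> H" unfolding d_def using assms(1) m by (rule add_mem)
  have "ip f d = ip g d"
    using assms(3)[OF d] ip_cnj[OF d assms(1)] ip_cnj[OF d assms(2)] by simp
  moreover have "ip d d = ip f d + (- 1) * ip g d"
    using ip_add[OF assms(1) m d] ip_scale[OF assms(2) d, of "-1"] by (simp add: d_def)
  ultimately have "d = (\<lambda>z. 0)" by (intro ip_definite d) simp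
  then show ?thesis by (simp add: d_def fun_eq_iff)
qed

lemma adjoint_symmetric:
  assumes "is_adjoint H ip A B" "\<And>f. f \<in> H \<Longrightarrow> A f \<in> H"
  shows "is_adjoint H ip B A"
  unfolding is_adjoint_def
proof (intro conjI ballI)
  fix f g assume fg: "f \<in> H" "g \<in> H"
  have "ip (B f) g = cnj (ip g (B f))"
    using assms(1) fg by (intro ip_cnj) (auto simp: is_adjoint_def)
  also have "\<dots> = cnj (ip (A g) f)"
    using assms(1) fg by (simp add: is_adjoint_def)
  also have "\<dots> = ip f (A g)"
    using assms fg ip_cnj[of "A g" f] by simp
  finally show "ip (B f) g = ip f (A g)" .
qed (use assms in auto)

text \<open>
  The choice behind \<^const>\<open>hadjoint\<close> is harmless: once an adjoint is known, any other
  one agrees with it on \<open>H\<close>.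
\<close>

lemma hadjoint_eq:
  assumes "is_adjoint H ip A B" "f \<in> H"
  shows "hadjoint H ip A f = B f"
proof -
  have "is_adjoint H ip A (hadjoint H ip A)"
    unfolding hadjoint_def using assms(1) by (rule someI[where P = "is_adjoint H ip A"])
  then show ?thesis
    using assms unfolding is_adjoint_def by (intro eq_if_ip_eq) auto
qed

end

text \<open>
  The points are an indexed family instead of a set, so that sums over exponents of roots of unity
  fit without reindexing.
\<close>

definition kernel_combination ::
  "'a set \<Rightarrow> ('a \<Rightarrow> 'a \<Rightarrow> complex) \<Rightarrow> 'p set \<Rightarrow> ('p \<Rightarrow> 'a) \<Rightarrow> ('p \<Rightarrow> complex) \<Rightarrow> 'a \<Rightarrow> complex"
  where "kernel_combination \<Omega> K P W c = (\<lambda>z. \<Sum>p\<in>P. c p * (if z \<in> \<Omega> then K z (W p) else 0))"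

lemma kernel_combination_sum:
  "(\<Sum>j\<in>J. d j * kernel_combination \<Omega> K P W (c j) z)
     = kernel_combination \<Omega> K P W (\<lambda>p. \<Sum>j\<in>J. d j * c j p) z"
  unfolding kernel_combination_def sum_distrib_left sum_distrib_right mult.assoc
  by (rule sum.swap)

context reproducing_kernel_hilbert_space
begin

lemma kernel_combination_mem:
  assumes "finite P" "\<And>p. p \<in> P \<Longrightarrow> W p \<in> \<Omega>"
  shows "kernel_combination \<Omega> K P W c \<in> H"
  unfolding kernel_combination_def using assms by (intro sum_mem kernel_mem)

lemma ip_kernel_combination:
  assumes "finite P" "\<And>p. p \<in> P \<Longrightarrow> W p \<in> \<Omega>" "g \<in> H"
  shows "ip g (kernel_combination \<Omega> K P W c) = (\<Sum>p\<in>P. cnj (c p) * g (W p))"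
  using assms unfolding kernel_combination_def
  by (subst ip_sum_right) (auto simp: kernel_mem reproducing)

end

text \<open>
  Kernel functions are joint eigenvectors of the adjoints of the coordinate multiplications:
  pairing with \<open>h\<close> gives \<open>\<langle>h, T\<^sub>i k\<^sub>w\<rangle> = \<langle>z\<^sub>i h, k\<^sub>w\<rangle> = w\<^sub>i h(w)\<close>.
\<close>

lemma adjoint_mult_coord_kernel_combination:
  fixes \<Omega> :: "(complex ^ 'm) set"
  assumes "reproducing_kernel_hilbert_space \<Omega> K H ip"
    and "bounded_operator H ip (mult_coord i)" and adj: "is_adjoint H ip (mult_coord i) S"
    and P: "finite P" "\<And>p. p \<in> P \<Longrightarrow> W p \<in> \<Omega>"
  shows "S (kernel_combination \<Omega> K P W c)
           = kernel_combination \<Omega> K P W (\<lambda>p. cnj (W p $ i) * c p)"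
proof -
  interpret reproducing_kernel_hilbert_space \<Omega> K H ip by fact
  note mem = kernel_combination_mem[OF P]
  show ?thesis
  proof (rule eq_if_ip_eq)
    show "S (kernel_combination \<Omega> K P W c) \<in> H"
      using adj mem by (auto simp: is_adjoint_def)
    fix h assume h: "h \<in> H"
    then have zh: "mult_coord i h \<in> H"
      using assms(2) by (auto simp: bounded_operator_def)
    have "ip h (S (kernel_combination \<Omega> K P W c)) = ip (mult_coord i h) (kernel_combination \<Omega> K P W c)"
      using adj h mem by (simp add: is_adjoint_def)
    then show "ip h (S (kernel_combination \<Omega> K P W c))
        = ip h (kernel_combination \<Omega> K P W (\<lambda>p. cnj (W p $ i) * c p))"
      by (simp add: ip_kernel_combination P h zh) (simp add: mult_coord_def mult_ac)
  qed (rule mem)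
qed

text \<open>
  Each application of \<open>\<^bold>M\<^sub>T\<close> contributes \<open>cnj w\<^sub>i\<close> from \<open>T\<^sub>i\<close> on the inside and \<open>z\<^sub>i\<close> from \<open>T\<^sub>i\<^sup>*\<close> on the
  outside, hence a factor \<open>\<langle>z, w\<rangle>\<close> after summation over \<open>i\<close>. Membership in \<open>H\<close> is proved along
  with the formula because \<open>T\<^sub>i\<^sup>*\<close> is known to be multiplication by \<open>z\<^sub>i\<close> only on \<open>H\<close>.
\<close>

lemma conj_map_funpow_kernel_combination:
  fixes \<Omega> :: "(complex ^ 'm) set"
  assumes "reproducing_kernel_hilbert_space \<Omega> K H ip"
    and shifts: "backward_weighted_shifts H ip T"
    and P: "finite P" "\<And>p. p \<in> P \<Longrightarrow> W p \<in> \<Omega>"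
  shows "(conj_map H ip T ^^ j) id (kernel_combination \<Omega> K P W c) \<in> H"
    and "(conj_map H ip T ^^ j) id (kernel_combination \<Omega> K P W c) z
      = kernel_combination \<Omega> K P W (\<lambda>p. (\<Sum>i\<in>UNIV. z $ i * cnj (W p $ i)) ^ j * c p) z"
proof -
  interpret reproducing_kernel_hilbert_space \<Omega> K H ip by fact
  let ?f = "kernel_combination \<Omega> K P W"
  have bdd: "bounded_operator H ip (mult_coord i)" and adj: "is_adjoint H ip (mult_coord i) (T i)"
    for i using shifts by (auto simp: backward_weighted_shifts_def)
  have mult_mem: "mult_coord i f \<in> H" if "f \<in> H" for i f
    using bdd[of i] that by (auto simp: bounded_operator_def)
  have had: "hadjoint H ip (T i) g = mult_coord i g" if "g \<in> H" for i g
    by (rule hadjoint_eq[OF adjoint_symmetric[OF adj mult_mem] that])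
  have T: "T i (?f c) = ?f (\<lambda>p. cnj (W p $ i) * c p)" for i c
    by (rule adjoint_mult_coord_kernel_combination[OF assms(1) bdd adj P])
  have "(conj_map H ip T ^^ j) id (?f c) \<in> H \<and> (\<forall>z. (conj_map H ip T ^^ j) id (?f c) z
      = ?f (\<lambda>p. (\<Sum>i\<in>UNIV. z $ i * cnj (W p $ i)) ^ j * c p) z)"
  proof (induction j arbitrary: c)
    case 0
    then show ?case by (simp add: kernel_combination_mem P)
  next
    case (Suc j)
    let ?X = "(conj_map H ip T ^^ j) id"
    have X_mem: "?X (T i (?f c)) \<in> H" for i
      unfolding T using Suc by blast
    have X: "(conj_map H ip T ^^ Suc j) id (?f c)
        = (\<lambda>z. \<Sum>i\<in>UNIV. 1 * mult_coord i (?X (T i (?f c))) z)"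
      by (simp add: conj_map_def[of H ip T ?X] had X_mem)
    then have "(conj_map H ip T ^^ Suc j) id (?f c) \<in> H"
      unfolding X by (intro sum_mem mult_mem X_mem) auto
    moreover have "(conj_map H ip T ^^ Suc j) id (?f c) z
        = ?f (\<lambda>p. (\<Sum>i\<in>UNIV. z $ i * cnj (W p $ i)) ^ Suc j * c p) z" for z
    proof -
      have IH: "?X (?f c') z = ?f (\<lambda>p. (\<Sum>i\<in>UNIV. z $ i * cnj (W p $ i)) ^ j * c' p) z" for c'
        using Suc by blast
      show ?thesis
        unfolding X mult_coord_def T IH mult_1 kernel_combination_sum
        by (simp add: sum_distrib_left sum_distrib_right mult_ac)
    qed
    ultimately show ?case by blast
  qed
  then show "(conj_map H ip T ^^ j) id (kernel_combination \<Omega> K P W c) \<in> H"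
    and "(conj_map H ip T ^^ j) id (kernel_combination \<Omega> K P W c) z
      = kernel_combination \<Omega> K P W (\<lambda>p. (\<Sum>i\<in>UNIV. z $ i * cnj (W p $ i)) ^ j * c p) z"
    by blast+
qed

text \<open>
  The binomial theorem collects the powers \<open>\<langle>z, w\<rangle>\<^sup>j\<close> into \<open>(1 - \<langle>z, w\<rangle>)\<^sup>n\<close>, and the reproducing
  property evaluates the inner product at the points \<open>W\<^sub>q\<close>.
\<close>

lemma ip_defect_operator_kernel_combination:
  fixes \<Omega> :: "(complex ^ 'm) set"
  assumes "reproducing_kernel_hilbert_space \<Omega> K H ip"
    and shifts: "backward_weighted_shifts H ip T"
    and P: "finite P" "\<And>p. p \<in> P \<Longrightarrow> W p \<in> \<Omega>"
  shows "kernel_combination \<Omega> K P W c \<in> H" (is "?f \<in> H")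
    and "ip (defect_operator H ip T n (kernel_combination \<Omega> K P W c)) (kernel_combination \<Omega> K P W c)
     = (\<Sum>p\<in>P. \<Sum>q\<in>P. c p * cnj (c q) *
          ((1 - (\<Sum>i\<in>UNIV. W q $ i * cnj (W p $ i))) ^ n * K (W q) (W p)))"
proof -
  interpret reproducing_kernel_hilbert_space \<Omega> K H ip by fact
  note power = conj_map_funpow_kernel_combination[OF assms(1) shifts P]
  show f: "?f \<in> H" by (rule kernel_combination_mem[OF P])
  have mem: "defect_operator H ip T n ?f \<in> H"
    unfolding defect_operator_def by (intro sum_mem power(1)) simp
  have val: "defect_operator H ip T n ?f z = kernel_combination \<Omega> K P W
      (\<lambda>p. (1 - (\<Sum>i\<in>UNIV. z $ i * cnj (W p $ i))) ^ n * c p) z" for z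
  proof -
    have binom: "(\<Sum>j=0..n. (-1) ^ j * of_nat (n choose j) * (x ^ j * d)) = (1 - x) ^ n * d"
      for x d :: complex
      using binomial_ring[of "- x" 1 n]
      by (simp add: atLeast0AtMost sum_distrib_left sum_distrib_right mult_ac power_minus[of x])
    show ?thesis
      by (simp only: defect_operator_def power(2) kernel_combination_sum binom)
  qed
  have "ip (defect_operator H ip T n ?f) ?f
      = (\<Sum>q\<in>P. cnj (c q) * defect_operator H ip T n ?f (W q))"
    by (rule ip_kernel_combination[OF P mem])
  also have "\<dots> = (\<Sum>q\<in>P. \<Sum>p\<in>P. c p * cnj (c q) *
          ((1 - (\<Sum>i\<in>UNIV. W q $ i * cnj (W p $ i))) ^ n * K (W q) (W p)))"
    unfolding val
    unfolding kernel_combination_def sum_distrib_left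
    by (intro sum.cong refl) (simp add: P mult_ac)
  finally show "ip (defect_operator H ip T n ?f) ?f
     = (\<Sum>p\<in>P. \<Sum>q\<in>P. c p * cnj (c q) *
          ((1 - (\<Sum>i\<in>UNIV. W q $ i * cnj (W p $ i))) ^ n * K (W q) (W p)))"
    by (subst sum.swap)
qed


section \<open>The inequality for hypercontractive shifts\<close>

lemma open_contains_torus:
  fixes \<Omega> :: "(complex ^ 'm) set"
  assumes "open \<Omega>" "0 \<in> \<Omega>"
  obtains r where "r > 0" "\<And>z. (\<And>i. norm (z $ i) = r) \<Longrightarrow> z \<in> \<Omega>"
proof -
  obtain e where e: "e > 0" "ball 0 e \<subseteq> \<Omega>"
    using assms openE by blast
  define r where "r = e / (2 * real CARD('m))"
  show thesis
  proof
    show "r > 0" using e by (simp add: r_def)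
    fix z :: "complex ^ 'm" assume z: "\<And>i. norm (z $ i) = r"
    have "norm z \<le> (\<Sum>i\<in>UNIV. norm (z $ i))"
      unfolding norm_vec_def by (rule L2_set_le_sum) simp
    also have "\<dots> < e" using e by (simp add: z r_def)
    finally show "z \<in> \<Omega>" using e by auto
  qed
qed

lemma shift_diff_funpow_nonneg:
  fixes \<rho> :: "nat ^ 'm \<Rightarrow> real"
  assumes space: "power_series_kernel_space \<rho> \<Omega> H ip"
    and shifts: "backward_weighted_shifts H ip T"
    and defect: "positive_operator H ip (defect_operator H ip T n)"
  shows "(shift_diff ^^ n) \<rho> \<alpha> \<ge> 0"
proof -
  obtain K where rkhs: "reproducing_kernel_hilbert_space \<Omega> K H ip"
    and series: "\<And>z w. z \<in> \<Omega> \<Longrightarrow> w \<in> \<Omega> \<Longrightarrow>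
      ((\<lambda>\<alpha>. of_real (\<rho> \<alpha>) * monomial \<alpha> z * cnj (monomial \<alpha> w)) has_sum K z w) UNIV"
    and "open \<Omega>" "0 \<in> \<Omega>"
    using space by (auto simp: power_series_kernel_space_def)
  then obtain r where r: "r > 0" "\<And>z. (\<And>i. norm (z $ i) = r) \<Longrightarrow> z \<in> \<Omega>"
    using open_contains_torus by blast
  show ?thesis
  proof (rule coefficients_nonneg_if_positive_definite[OF r(1)])
    fix z w :: "complex ^ 'm"
    assume "\<And>i. norm (z $ i) = r" "\<And>i. norm (w $ i) = r"
    then show "((\<lambda>\<alpha>. of_real ((shift_diff ^^ n) \<rho> \<alpha>) * monomial \<alpha> z * cnj (monomial \<alpha> w))
        has_sum ((1 - (\<Sum>i\<in>UNIV. z $ i * cnj (w $ i))) ^ n * K z w)) UNIV"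
      by (intro has_sum_shift_diff_funpow series r(2))
  next
    fix P :: "('m \<Rightarrow> nat) set" and c and W :: "('m \<Rightarrow> nat) \<Rightarrow> complex ^ 'm"
    assume P: "finite P" and "\<And>p i. p \<in> P \<Longrightarrow> norm (W p $ i) = r"
    then have W: "\<And>p. p \<in> P \<Longrightarrow> W p \<in> \<Omega>" by (intro r(2))
    let ?f = "kernel_combination \<Omega> K P W c"
    have "ip (defect_operator H ip T n ?f) ?f \<in> \<real>\<^sub>\<ge>\<^sub>0"
      using defect ip_defect_operator_kernel_combination(1)[OF rkhs shifts P W]
      by (auto simp: positive_operator_def)
    then show "0 \<le> Re (\<Sum>p\<in>P. \<Sum>q\<in>P. c p * cnj (c q) *
        ((1 - (\<Sum>i\<in>UNIV. W q $ i * cnj (W p $ i))) ^ n * K (W q) (W p)))"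
      by (simp only: ip_defect_operator_kernel_combination(2)[OF rkhs shifts P W]
          complex_nonneg_Reals_iff)
  qed
qed

theorem theorem1p4:
  fixes \<rho> :: "nat ^ 'm \<Rightarrow> real"
    and \<Omega> :: "(complex ^ 'm) set"
    and H :: "(complex ^ 'm \<Rightarrow> complex) set"
    and ip :: "(complex ^ 'm \<Rightarrow> complex) \<Rightarrow> (complex ^ 'm \<Rightarrow> complex) \<Rightarrow> complex"
    and T :: "'m \<Rightarrow> (complex ^ 'm \<Rightarrow> complex) \<Rightarrow> (complex ^ 'm \<Rightarrow> complex)"
    and n :: nat
  assumes "CARD('m) \<ge> 2" and "n \<ge> 1"
    and "\<And>\<alpha>. \<rho> \<alpha> > 0"
    and "power_series_kernel_space \<rho> \<Omega> H ip"
    and "backward_weighted_shifts H ip T"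
    and "commuting_tuple H ip T"
    and "hypercontraction H ip n T"
  shows "\<forall>\<alpha>. \<alpha> \<noteq> 0 \<longrightarrow>
    (\<Sum>\<beta> | \<beta> \<le> \<alpha> \<and> mdeg (\<alpha> - \<beta>) = 1. \<rho> \<beta> / \<rho> \<alpha>)
      \<le> real (mdeg \<alpha>) / (real (mdeg \<alpha>) + real n - 1)"
proof (intro allI impI)
  fix \<alpha> :: "nat ^ 'm" assume "\<alpha> \<noteq> 0"
  then have deg: "mdeg \<alpha> \<ge> 1"
    by (auto simp: mdeg_def vec_eq_iff Suc_le_eq intro!: sum_pos2)
  obtain k where n: "n = Suc k" using \<open>n \<ge> 1\<close> by (cases n) auto
  have "positive_operator H ip (defect_operator H ip T n)"
    using assms(2,7) by (auto simp: hypercontraction_def)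
  then have "(shift_diff ^^ Suc k) \<rho> \<beta> \<ge> 0" for \<beta>
    using shift_diff_funpow_nonneg[OF assms(4,5)] n by blast
  from shift_sum_le_mdeg_shift_diff[OF this]
  have "(real (mdeg \<alpha>) + real k) * shift_sum \<rho> \<alpha> \<le> real (mdeg \<alpha>) * \<rho> \<alpha>"
    by (simp add: shift_diff_def algebra_simps)
  then have "shift_sum \<rho> \<alpha> / \<rho> \<alpha> \<le> real (mdeg \<alpha>) / (real (mdeg \<alpha>) + real n - 1)"
    using deg assms(3)[of \<alpha>] by (simp add: n field_simps)
  then show "(\<Sum>\<beta> | \<beta> \<le> \<alpha> \<and> mdeg (\<alpha> - \<beta>) = 1. \<rho> \<beta> / \<rho> \<alpha>)
      \<le> real (mdeg \<alpha>) / (real (mdeg \<alpha>) + real n - 1)"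
    by (simp only: sum_divide_distrib[symmetric] sum_lower_neighbours)
qed

end
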